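(* There is an absolute constant $C>0$ such that for every $d\ge1$, every $p\in[1,\infty]$ and every $\epsilon\in(0,1)$ there exists a one-sided, non-adaptive $(\epsilon,\ell_p)$-tester for real symmetric $d\times d$ matrices that makes at most $C\,\frac{1}{\epsilon}d^{1-1/p}$ matrix-vector queries (with $1/p=0$ for $p=\infty$).
   Context: For a real symmetric matrix $A$, $\|A\|_p$ denotes the Schatten-$p$ norm (the $\ell_p$ norm of the vector of singular values; $\|A\|_\infty$ is the operator norm), and $\lambda_{\min}(A)$ its smallest eigenvalue. PSD means positive semidefinite. In the matrix-vector model, a randomized algorithm has access to an unknown real symmetric $d\times d$ matrix $A$ only through queries in which it chooses $v\in\mathbb{R}^d$ and receives $Av$. It is non-adaptive if all query vectors are chosen (possibly at random) before any answer is received. Computation is otherwise free; the number of queries is counted in the worst case over inputs and coins. For $p\in[1,\infty]$ and $\epsilon\in(0,1)$, an $(\epsilon,\ell_p)$-tester is such an algorithm that outputs True with probability at least $2/3$ if $A$ is PSD, and outputs False with probability at least $2/3$ if $A\neq 0$ and $\lambda_{\min}(A)\le-\epsilon\|A\|_p$. The tester is one-sided if on every PSD input it outputs True for every outcome of its random coins. *)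

theory Defs
  imports "HOL-Probability.Probability" "Jordan_Normal_Form.Spectral_Radius"
begin

unbundle no inner_syntax

definition sym_mats :: "nat \<Rightarrow> real mat set" where
  "sym_mats d = {A \<in> carrier_mat d d. A\<^sup>T = A}"

definition psd :: "real mat \<Rightarrow> bool" where
  "psd A \<longleftrightarrow> A \<in> sym_mats (dim_row A) \<and>
     (\<forall>v \<in> carrier_vec (dim_row A). 0 \<le> v \<bullet> (A *\<^sub>v v))"

definition lambda_min :: "real mat \<Rightarrow> real" where
  "lambda_min A = Min (spectrum A)"

definition singular_values :: "real mat \<Rightarrow> real multiset" where
  "singular_values A = image_mset sqrt (proots (char_poly (A\<^sup>T * A)))"

(* Intended for square matrices of positive dimension, so that Max ranges over a nonempty set. *)
definition schatten_norm :: "ereal \<Rightarrow> real mat \<Rightarrow> real" where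
  "schatten_norm p A =
     (if p = \<infinity> then Max (set_mset (singular_values A))
      else (\<Sum>s \<in># singular_values A. s powr real_of_ereal p) powr (1 / real_of_ereal p))"

(* Matrix-vector query algorithms, possibly adaptive. All randomness is in one outcome w of the
   probability space coins. From w and the list of answers received so far (which determine the
   earlier queries), next_query gives the next query vector, or None to stop; after stopping,
   decide gives the output. *)
record 'w mv_algorithm =
  coins :: "'w measure"
  next_query :: "'w \<Rightarrow> real vec list \<Rightarrow> real vec option"
  decide :: "'w \<Rightarrow> real vec list \<Rightarrow> bool"

primrec answers :: "'w mv_algorithm \<Rightarrow> real mat \<Rightarrow> 'w \<Rightarrow> nat \<Rightarrow> real vec list" where
  "answers T A w 0 = []"
| "answers T A w (Suc n) =
     (case next_query T w (answers T A w n) of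
        None \<Rightarrow> answers T A w n
      | Some v \<Rightarrow> answers T A w n @ [A *\<^sub>v v])"

definition stopped :: "'w mv_algorithm \<Rightarrow> real mat \<Rightarrow> 'w \<Rightarrow> nat \<Rightarrow> bool" where
  "stopped T A w n \<longleftrightarrow> next_query T w (answers T A w n) = None"

definition num_queries :: "'w mv_algorithm \<Rightarrow> real mat \<Rightarrow> 'w \<Rightarrow> nat" where
  "num_queries T A w = (LEAST n. stopped T A w n)"

definition run_output :: "'w mv_algorithm \<Rightarrow> real mat \<Rightarrow> 'w \<Rightarrow> bool" where
  "run_output T A w = decide T w (answers T A w (num_queries T A w))"

(* The symmetric matrix whose entries on and above the diagonal are given by a. *)
definition sym_mat_of :: "nat \<Rightarrow> (nat \<times> nat \<Rightarrow> real) \<Rightarrow> real mat" where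
  "sym_mat_of d a = mat d d (\<lambda>(i, j). a (min i j, max i j))"

(* The output is required to be jointly measurable in the coins and the matrix entries. With
   measurability only for each fixed matrix, a non-measurable dependence of the queries on the
   coins would be allowed, for which averaging arguments over random inputs fail. *)
definition valid_algorithm :: "nat \<Rightarrow> 'w mv_algorithm \<Rightarrow> bool" where
  "valid_algorithm d T \<longleftrightarrow>
     prob_space (coins T) \<and>
     (\<forall>w \<in> space (coins T). \<forall>ys v. next_query T w ys = Some v \<longrightarrow> v \<in> carrier_vec d) \<and>
     (\<forall>A \<in> sym_mats d. \<forall>w \<in> space (coins T). \<exists>n. stopped T A w n) \<and>
     Measurable.pred (coins T \<Otimes>\<^sub>M Pi\<^sub>M {(i, j). i \<le> j \<and> j < d} (\<lambda>_. borel))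
       (\<lambda>(w, a). run_output T (sym_mat_of d a) w)"

definition non_adaptive :: "'w mv_algorithm \<Rightarrow> bool" where
  "non_adaptive T \<longleftrightarrow>
     (\<exists>Q. \<forall>w \<in> space (coins T). \<forall>ys.
        next_query T w ys = (if length ys < length (Q w) then Some (Q w ! length ys) else None))"

definition is_tester :: "nat \<Rightarrow> real \<Rightarrow> ereal \<Rightarrow> 'w mv_algorithm \<Rightarrow> bool" where
  "is_tester d \<epsilon> p T \<longleftrightarrow>
     valid_algorithm d T \<and>
     (\<forall>A \<in> sym_mats d.
        (psd A \<longrightarrow> measure (coins T) {w \<in> space (coins T). run_output T A w} \<ge> 2 / 3) \<and>
        (A \<noteq> 0\<^sub>m d d \<and> lambda_min A \<le> - \<epsilon> * schatten_norm p A \<longrightarrow>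
           measure (coins T) {w \<in> space (coins T). \<not> run_output T A w} \<ge> 2 / 3))"

definition one_sided :: "nat \<Rightarrow> 'w mv_algorithm \<Rightarrow> bool" where
  "one_sided d T \<longleftrightarrow>
     (\<forall>A \<in> sym_mats d. psd A \<longrightarrow> (\<forall>w \<in> space (coins T). run_output T A w))"

end

theory Submission
  imports Defs
begin

text \<open>
  Since \<open>\<parallel>A\<parallel>\<^sub>1 \<le> d powr (1 - 1/p) * \<parallel>A\<parallel>\<^sub>p\<close>, it suffices to treat \<open>p = 1\<close> with \<open>O(1/\<epsilon>)\<close> queries.
  Query \<open>m\<close> independent uniform sign vectors \<open>g\<^sub>i\<close> and accept iff the form \<open>\<Sum> c\<^sub>i c\<^sub>k g\<^sub>i \<bullet> A g\<^sub>k\<close> in \<open>c\<close> is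
  nonnegative, which never rejects a PSD matrix.
  If \<open>v\<close> is a unit eigenvector for the least eigenvalue \<open>-\<lambda>\<close>, take \<open>c\<^sub>i = v \<bullet> g\<^sub>i\<close> and \<open>x = \<Sum> c\<^sub>i g\<^sub>i\<close>.
  Fourth moments of sign sums show that \<open>v \<bullet> x = \<Sum> c\<^sub>i\<^sup>2\<close> has mean \<open>m\<close> and variance at most \<open>2m\<close>, while
  \<open>(w \<bullet> x)\<^sup>2\<close> has mean at most \<open>m\<close> for every other vector \<open>w\<close> of an orthonormal eigenbasis. Hence
  \<open>x \<bullet> A x\<close> is at most \<open>- \<lambda> (v \<bullet> x)\<^sup>2 \<approx> - \<lambda> m\<^sup>2\<close> plus a nonnegative term of mean at most \<open>m \<parallel>A\<parallel>\<^sub>1\<close>, and it is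
  negative with probability at least \<open>2/3\<close> as soon as \<open>\<lambda> m \<ge> 36 \<parallel>A\<parallel>\<^sub>1\<close>.
\<close>

section \<open>Spectral theorem for real symmetric matrices\<close>

text \<open>Over the complex numbers an eigenvalue exists. Moving the symmetric real matrix across
  \<open>v \<bullet> conjugate v\<close>, which is nonzero, shows that the eigenvalue equals its own
  conjugate. A real root of the complexified characteristic polynomial is then a root of the real
  one.\<close>

lemma symmetric_real_eigenvalue:
  fixes A :: "real mat"
  assumes A: "A \<in> carrier_mat n n" and sym: "A\<^sup>T = A" and n: "n > 0"
  shows "\<exists>e. eigenvalue A e"
proof -
  let ?B = "map_mat complex_of_real A"
  have B: "?B \<in> carrier_mat n n" using A by auto
  obtain k where "k \<in> spectrum ?B" using spectrum_non_empty[OF B n] by auto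
  then obtain v where v: "v \<in> carrier_vec n" and v0: "v \<noteq> 0\<^sub>v n" and ev: "?B *\<^sub>v v = k \<cdot>\<^sub>v v"
    unfolding spectrum_def eigenvalue_def eigenvector_def using A by auto
  have cv: "conjugate v \<in> carrier_vec n" using v by simp
  have symB: "?B\<^sup>T = ?B"
    using sym A by (metis map_mat_transpose)
  have conj: "?B *\<^sub>v conjugate v = conjugate (?B *\<^sub>v v)"
    using A v by (intro eq_vecI) (auto simp: scalar_prod_def)
  have "k * (v \<bullet> conjugate v) = (?B *\<^sub>v v) \<bullet> conjugate v"
    using ev v cv by simp
  also have "\<dots> = v \<bullet> (?B *\<^sub>v conjugate v)"
    using transpose_vec_mult_scalar[OF B cv v] symB by simp
  also have "\<dots> = cnj k * (v \<bullet> conjugate v)"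
    unfolding conj ev using v cv by (simp add: conjugate_smult_vec)
  finally have "k = cnj k"
    using conjugate_square_eq_0_vec[OF v] v0 by simp
  then obtain r where k: "k = complex_of_real r"
    by (metis Reals_cnj_iff Reals_cases)
  have "poly (char_poly ?B) k = 0"
    using v v0 ev A eigenvalue_root_char_poly[OF B, of k]
    unfolding eigenvalue_def eigenvector_def by auto
  then have "poly (char_poly A) r = 0"
    unfolding of_real_hom.char_poly_hom[OF A] k by simp
  then show ?thesis using eigenvalue_root_char_poly[OF A] by blast
qed

text \<open>Complete \<open>v\<close> to a basis, apply Gram-Schmidt, which keeps the head of the
  list, and normalise; \<open>c\<close> is the normalising factor. This is the change of basis for
  the deflation below.\<close>

lemma orthogonal_matrix_with_first_column:
  fixes v :: "real vec"
  assumes v: "v \<in> carrier_vec n" and v0: "v \<noteq> 0\<^sub>v n"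
  obtains W c where "W \<in> carrier_mat n n" "W\<^sup>T * W = 1\<^sub>m n" "col W 0 = c \<cdot>\<^sub>v v"
proof -
  interpret cof_vec_space n "TYPE(real)" .
  define b where "b = basis_completion v"
  note bc = basis_completion[OF v v0, folded b_def]
  then have b: "set b \<subseteq> carrier_vec n" "distinct b" "\<not> lin_dep (set b)" "hd b = v" "length b = n"
    by auto
  have n: "n > 0" using v v0 by (cases n) auto
  then obtain vs where bv: "b = v # vs" using b by (cases b) auto
  define ws where "ws = gram_schmidt n b"
  have ws: "set ws \<subseteq> carrier_vec n" "corthogonal ws" "length ws = n"
    using gram_schmidt_result[OF b(1,2,3) ws_def] b(5) by auto
  have "hd ws = v" using gram_schmidt_hd[OF v, of vs] unfolding ws_def bv .
  then have ws0: "ws ! 0 = v" using ws n by (simp add: hd_conv_nth flip: length_greater_0_conv)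
  define u where "u = map (\<lambda>w. (1 / sqrt (w \<bullet> w)) \<cdot>\<^sub>v w) ws"
  define W where "W = mat_of_cols n u"
  have wsc: "ws ! i \<in> carrier_vec n" if "i < n" for i using ws that by auto
  have W: "W \<in> carrier_mat n n" unfolding W_def u_def using ws by auto
  have colW: "col W i = (1 / sqrt (ws ! i \<bullet> ws ! i)) \<cdot>\<^sub>v ws ! i" if "i < n" for i
    unfolding W_def u_def using ws that wsc[OF that] by simp
  have "(W\<^sup>T * W) $$ (i, j) = 1\<^sub>m n $$ (i, j)" if i: "i < n" and j: "j < n" for i j
  proof -
    \<comment> \<open>\<open>corthogonal\<close> is phrased with conjugation, which is trivial on
      real vectors.\<close>
    have conj: "conjugate w = w" for w :: "real vec" by auto
    have orth: "ws ! i \<bullet> ws ! j = 0 \<longleftrightarrow> i \<noteq> j" if "i < n" "j < n" for i j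
      using corthogonalD[OF ws(2), of i j] ws(3) that conj by auto
    have "(W\<^sup>T * W) $$ (i, j) = col W i \<bullet> col W j" using W i j by simp
    also have "\<dots> = (ws ! i \<bullet> ws ! j) / (sqrt (ws ! i \<bullet> ws ! i) * sqrt (ws ! j \<bullet> ws ! j))"
      unfolding colW[OF i] colW[OF j] using wsc[OF i] wsc[OF j] by simp
    also have "\<dots> = (if i = j then 1 else 0)"
    proof (cases "i = j")
      case True
      moreover have "ws ! i \<bullet> ws ! i \<ge> 0" by (simp add: scalar_prod_def sum_nonneg)
      ultimately show ?thesis using orth[OF i i] by simp
    next
      case False
      then show ?thesis using orth[OF i j] by simp
    qed
    finally show ?thesis using i j by simp
  qed
  then have "W\<^sup>T * W = 1\<^sub>m n" using W by (intro eq_matI) auto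
  with W colW[OF n] ws0 show ?thesis using that by simp
qed

text \<open>Deflation: in an orthonormal basis that starts with an eigenvector, a symmetric matrix
  splits into a 1 by 1 block and a smaller symmetric block, to which induction applies.\<close>

lemma real_symmetric_spectral:
  fixes A :: "real mat"
  assumes "A \<in> carrier_mat n n" "A\<^sup>T = A"
  shows "\<exists>W \<mu>. W \<in> carrier_mat n n \<and> W\<^sup>T * W = 1\<^sub>m n \<and> A * W = W * mat_diag n \<mu>"
  using assms
proof (induction n arbitrary: A)
  case 0
  then show ?case by (intro exI[of _ "1\<^sub>m 0"] exI[of _ "\<lambda>_. 0"]) (auto simp: mat_diag_def intro!: eq_matI)
next
  case (Suc n A)
  note A = Suc.prems(1)
  obtain e v where v: "v \<in> carrier_vec (Suc n)" "v \<noteq> 0\<^sub>v (Suc n)" "A *\<^sub>v v = e \<cdot>\<^sub>v v"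
    using symmetric_real_eigenvalue[OF Suc.prems] A
    unfolding eigenvalue_def eigenvector_def by auto
  obtain W c where W: "W \<in> carrier_mat (Suc n) (Suc n)" "W\<^sup>T * W = 1\<^sub>m (Suc n)" "col W 0 = c \<cdot>\<^sub>v v"
    using orthogonal_matrix_with_first_column[OF v(1,2)] by blast
  have WW: "W * W\<^sup>T = 1\<^sub>m (Suc n)"
    using mat_mult_left_right_inverse[of "W\<^sup>T" "Suc n" W] W by auto
  define B where "B = W\<^sup>T * A * W"
  have B: "B \<in> carrier_mat (Suc n) (Suc n)" unfolding B_def using W A by auto
  have symB: "B\<^sup>T = B"
    unfolding B_def using W A Suc.prems(2)
    by (simp add: transpose_mult[of _ "Suc n" "Suc n" _ "Suc n"])
  have "A *\<^sub>v col W 0 = e \<cdot>\<^sub>v col W 0"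
    unfolding W(3) using A v by (auto simp: mult_mat_vec smult_smult_assoc mult.commute)
  then have ev: "W\<^sup>T *\<^sub>v (A *\<^sub>v col W 0) = e \<cdot>\<^sub>v (W\<^sup>T *\<^sub>v col W 0)"
    using mult_mat_vec[of "W\<^sup>T" "Suc n" "Suc n" "col W 0" e] W(1) col_carrier_vec[of 0 "Suc n" W "Suc n"] by simp
  have "B = W\<^sup>T * (A * W)" unfolding B_def using W(1) A by simp
  then have "col B 0 = W\<^sup>T *\<^sub>v (A *\<^sub>v col W 0)"
    using W(1) A col_mult2[of "W\<^sup>T" "Suc n" "Suc n" "A * W" "Suc n" 0]
      col_mult2[of A "Suc n" "Suc n" W "Suc n" 0] by simp
  also have "\<dots> = e \<cdot>\<^sub>v col (W\<^sup>T * W) 0"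
    using ev W(1) col_mult2[of "W\<^sup>T" "Suc n" "Suc n" W "Suc n" 0] by simp
  finally have "col B 0 = e \<cdot>\<^sub>v col (W\<^sup>T * W) 0" .
  then have "B $$ (i, 0) = (e \<cdot>\<^sub>v col (1\<^sub>m (Suc n)) 0) $ i" if "i < Suc n" for i
    using B that W(2) by (metis carrier_matD index_col zero_less_Suc)
  then have colB: "B $$ (i, 0) = (if i = 0 then e else 0)" if "i < Suc n" for i
    using that by simp
  have rowB: "B $$ (0, j) = (if j = 0 then e else 0)" if "j < Suc n" for j
    using colB[OF that] symB B that by (metis carrier_matD index_transpose_mat(1) zero_less_Suc)
  define B3 where "B3 = mat n n (\<lambda>(i, j). B $$ (Suc i, Suc j))"
  have B3: "B3 \<in> carrier_mat n n" unfolding B3_def by simp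
  have "B $$ (Suc i, Suc j) = B $$ (Suc j, Suc i)" if "i < n" "j < n" for i j
    using symB B that by (metis Suc_less_eq carrier_matD index_transpose_mat(1))
  then have "B3\<^sup>T = B3" unfolding B3_def by (intro eq_matI) auto
  then obtain W3 \<mu> where W3: "W3 \<in> carrier_mat n n" "W3\<^sup>T * W3 = 1\<^sub>m n"
      "B3 * W3 = W3 * mat_diag n \<mu>"
    using Suc.IH[OF B3] by blast
  have Bblock: "B = four_block_mat (mat 1 1 (\<lambda>_. e)) (0\<^sub>m 1 n) (0\<^sub>m n 1) B3"
    using B B3 colB rowB unfolding B3_def by (intro eq_matI) (auto simp: gr0_conv_Suc less_Suc_eq_0_disj)
  \<comment> \<open>\<open>F\<close> diagonalises \<open>B\<close>, the matrix in the new basis;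
    changing back, \<open>W * F\<close> is the eigenbasis of \<open>A\<close>.\<close>
  define F where "F = four_block_mat (1\<^sub>m 1) (0\<^sub>m 1 n) (0\<^sub>m n 1) W3"
  define \<nu> where "\<nu> = (\<lambda>i. case i of 0 \<Rightarrow> e | Suc j \<Rightarrow> \<mu> j)"
  have F: "F \<in> carrier_mat (Suc n) (Suc n)" unfolding F_def using W3 by auto
  have D: "mat_diag (Suc n) \<nu> = four_block_mat (mat 1 1 (\<lambda>_. e)) (0\<^sub>m 1 n) (0\<^sub>m n 1) (mat_diag n \<mu>)"
    unfolding mat_diag_def \<nu>_def
    by (intro eq_matI) (auto simp: gr0_conv_Suc less_Suc_eq_0_disj)
  have Ft: "F\<^sup>T = four_block_mat (1\<^sub>m 1) (0\<^sub>m 1 n) (0\<^sub>m n 1) (W3\<^sup>T)"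
    unfolding F_def using W3 by (subst transpose_four_block_mat[of _ 1 1 _ n _ n]) auto
  have "F\<^sup>T * F = four_block_mat (1\<^sub>m 1) (0\<^sub>m 1 n) (0\<^sub>m n 1) (1\<^sub>m n)"
    unfolding Ft unfolding F_def using W3 by (subst mult_four_block_mat[of _ 1 1 _ n _ n _ _ 1 _ n]) auto
  also have "\<dots> = 1\<^sub>m (Suc n)" by (simp add: four_block_one_mat)
  finally have FF: "F\<^sup>T * F = 1\<^sub>m (Suc n)" .
  have BF: "B * F = F * mat_diag (Suc n) \<nu>"
    unfolding D F_def Bblock using W3 B3 left_mult_zero_mat[OF mat_diag_dim, of 1 n \<mu>]
    by (subst (1 2) mult_four_block_mat[of _ 1 1 _ n _ n _ _ 1 _ n]) auto
  have "W\<^sup>T * (W * F) = F"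
    using assoc_mult_mat[of "W\<^sup>T" "Suc n" "Suc n" W "Suc n" F "Suc n"] W F by simp
  then have 1: "(W * F)\<^sup>T * (W * F) = 1\<^sub>m (Suc n)"
    using transpose_mult[of W "Suc n" "Suc n" F "Suc n"] W(1) F FF
      assoc_mult_mat[of "F\<^sup>T" "Suc n" "Suc n" "W\<^sup>T" "Suc n" "W * F" "Suc n"] by simp
  have "W * F * mat_diag (Suc n) \<nu> = W * (B * F)"
    unfolding BF using assoc_mult_mat[OF W(1) F mat_diag_dim] by simp
  also have "B * F = W\<^sup>T * (A * (W * F))"
    unfolding B_def using W(1) F A
      assoc_mult_mat[of "W\<^sup>T * A" "Suc n" "Suc n" W "Suc n" F "Suc n"]
      assoc_mult_mat[of "W\<^sup>T" "Suc n" "Suc n" A "Suc n" "W * F" "Suc n"] by simp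
  also have "W * (W\<^sup>T * (A * (W * F))) = (W * W\<^sup>T) * (A * (W * F))"
    using W(1) F A assoc_mult_mat[of W "Suc n" "Suc n" "W\<^sup>T" "Suc n" "A * (W * F)" "Suc n"] by simp
  also have "\<dots> = A * (W * F)"
    unfolding WW using A W F by simp
  finally show ?case using 1 W(1) F by (metis mult_carrier_mat)
qed

section \<open>Orthonormal eigenbases, spectrum and singular values\<close>

text \<open>The columns of \<open>W\<close> are an orthonormal eigenbasis; \<open>\<mu>\<close>
  lists the eigenvalues with multiplicity and in no particular order.\<close>

definition spectral_decomp :: "nat \<Rightarrow> real mat \<Rightarrow> real mat \<Rightarrow> (nat \<Rightarrow> real) \<Rightarrow> bool" where
  "spectral_decomp n A W \<mu> \<longleftrightarrow> A \<in> carrier_mat n n \<and> W \<in> carrier_mat n n \<and>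
     W\<^sup>T * W = 1\<^sub>m n \<and> A * W = W * mat_diag n \<mu>"

lemma spectral_decompD:
  assumes "spectral_decomp n A W \<mu>"
  shows "A \<in> carrier_mat n n" "W \<in> carrier_mat n n" "W\<^sup>T * W = 1\<^sub>m n" "W * W\<^sup>T = 1\<^sub>m n"
    "A * W = W * mat_diag n \<mu>" "A = W * mat_diag n \<mu> * W\<^sup>T"
proof -
  show A: "A \<in> carrier_mat n n" and W: "W \<in> carrier_mat n n" and 1: "W\<^sup>T * W = 1\<^sub>m n"
    and 2: "A * W = W * mat_diag n \<mu>"
    using assms unfolding spectral_decomp_def by auto
  show 3: "W * W\<^sup>T = 1\<^sub>m n" using mat_mult_left_right_inverse[of "W\<^sup>T" n W] W 1 by auto
  have "W * mat_diag n \<mu> * W\<^sup>T = A * (W * W\<^sup>T)" 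
    using A W by (simp add: assoc_mult_mat[of _ n n _ n _ n] flip: 2)
  then show "A = W * mat_diag n \<mu> * W\<^sup>T" using 3 A by simp
qed

lemma symmetric_spectral_decomp:
  assumes "A \<in> sym_mats d"
  obtains W \<mu> where "spectral_decomp d A W \<mu>"
  using real_symmetric_spectral[of A d] assms unfolding sym_mats_def spectral_decomp_def by auto

lemma char_poly_mat_diag:
  "char_poly (mat_diag n f) = (\<Prod>a\<leftarrow>map f [0..<n]. [:- a, 1:])"
proof -
  have "diag_mat (mat_diag n f) = map f [0..<n]"
    unfolding diag_mat_def mat_diag_def by auto
  then show ?thesis
    using char_poly_upper_triangular[of "mat_diag n f" n] unfolding mat_diag_def by force
qed

lemma char_poly_spectral_decomp:
  assumes "spectral_decomp n A W \<mu>"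
  shows "char_poly A = (\<Prod>a\<leftarrow>map \<mu> [0..<n]. [:- a, 1:])"
proof -
  note D = spectral_decompD[OF assms]
  have "similar_mat A (mat_diag n \<mu>)"
    unfolding similar_mat_def
    using similar_mat_witI[OF D(4,3,6)] D by auto
  then show ?thesis using char_poly_similar char_poly_mat_diag by metis
qed

lemma proots_linear_factors:
  "proots (\<Prod>a\<leftarrow>xs. [:- a, 1 :: real:]) = mset xs"
proof (induction xs)
  case (Cons a xs)
  have "(\<Prod>a\<leftarrow>xs. [:- a, 1 :: real:]) \<noteq> 0" by (auto simp: prod_list_zero_iff)
  then show ?case using Cons proots_mult[of "[:- a, 1:]" "\<Prod>a\<leftarrow>xs. [:- a, 1:]"]
    by (simp del: mult_pCons_left)
qed simp

lemma spectrum_spectral_decomp: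
  assumes "spectral_decomp n A W \<mu>"
  shows "spectrum A = \<mu> ` {..<n}"
  unfolding spectrum_root_char_poly[OF spectral_decompD(1)[OF assms]]
    char_poly_spectral_decomp[OF assms]
  by (auto simp: poly_prod_list prod_list_zero_iff)

text \<open>For symmetric \<open>A\<close> the product \<open>A\<^sup>T * A\<close> is the square of
  \<open>A\<close>, so \<open>W\<close> diagonalises it with squared eigenvalues, whose roots are
  the absolute values.\<close>

lemma singular_values_spectral_decomp:
  assumes "spectral_decomp n A W \<mu>" "A\<^sup>T = A"
  shows "singular_values A = image_mset (\<lambda>i. \<bar>\<mu> i\<bar>) (mset_set {..<n})"
proof -
  note D = spectral_decompD[OF assms(1)]
  have "A * A * W = A * (A * W)" using D by (simp add: assoc_mult_mat[of _ n n _ n _ n])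
  also have "\<dots> = (A * W) * mat_diag n \<mu>"
    using D(1,2,5) assoc_mult_mat[of A n n W n "mat_diag n \<mu>" n] by simp
  also have "\<dots> = W * mat_diag n (\<lambda>i. \<mu> i * \<mu> i)"
    unfolding D(5) using assoc_mult_mat[of W n n "mat_diag n \<mu>" n "mat_diag n \<mu>" n] D(2) by simp
  finally have "spectral_decomp n (A\<^sup>T * A) W (\<lambda>i. \<mu> i * \<mu> i)"
    unfolding spectral_decomp_def assms(2) using D by auto
  note char_poly_spectral_decomp[OF this]
  then have "proots (char_poly (A\<^sup>T * A)) = image_mset (\<lambda>i. \<mu> i * \<mu> i) (mset_set {..<n})"
    by (simp only: proots_linear_factors) (simp add: lessThan_atLeast0)
  then show ?thesis
    unfolding singular_values_def by (simp add: image_mset.compositionality o_def)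
qed

section \<open>Comparison of Schatten norms\<close>

text \<open>Jensen's inequality for \<open>y powr r\<close>, obtained by summing the tangent line
  inequality at the mean \<open>c\<close>.\<close>

lemma power_mean:
  fixes x :: "'a \<Rightarrow> real"
  assumes I: "finite I" "I \<noteq> {}" and x: "\<And>i. i \<in> I \<Longrightarrow> 0 \<le> x i" and r: "1 \<le> r"
  shows "(\<Sum>i\<in>I. x i) \<le> real (card I) powr (1 - 1 / r) * (\<Sum>i\<in>I. x i powr r) powr (1 / r)"
proof (cases "(\<Sum>i\<in>I. x i) = 0")
  case False
  then have S: "(\<Sum>i\<in>I. x i) > 0" using x by (metis order_le_less sum_nonneg)
  define c where "c = (\<Sum>i\<in>I. x i) / card I"
  have n: "real (card I) > 0" using I by (simp add: card_gt_0_iff)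
  then have c: "c > 0" unfolding c_def using S by simp
  have tangent: "c powr r + r * c powr (r - 1) * (y - c) \<le> y powr r" if "0 \<le> y" for y
  \<comment> \<open>The convexity argument works on the open half-line. At \<open>y = 0\<close> the
    claim reduces to \<open>(1 - r) * c powr r \<le> 0\<close>.\<close>
  proof (cases "y = 0")
    case True
    have "c powr r = c powr (r - 1) * c" using c by (simp add: powr_diff)
    then show ?thesis using True r c by (simp add: algebra_simps mult_le_cancel_right1)
  next
    case False
    have "r * c powr (r - 1) * (y - c) \<le> y powr r - c powr r"
      by (rule convex_on_imp_above_tangent[where A="{0<..}" and f="\<lambda>x. x powr r"])
         (use False that c r in \<open>auto intro!: derivative_eq_intros powr_convex simp: interior_open convex_connected\<close>)
    then show ?thesis by simp
  qed
  \<comment> \<open>The linear terms cancel because \<open>c\<close> is the mean of the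
    \<open>x i\<close>.\<close>
  have "card I * c powr r = (\<Sum>i\<in>I. c powr r + r * c powr (r - 1) * (x i - c))"
    using n by (simp add: sum.distrib sum_subtractf flip: sum_distrib_left) (simp add: c_def)
  also have "\<dots> \<le> (\<Sum>i\<in>I. x i powr r)" by (intro sum_mono tangent x)
  finally have "(card I * c powr r) powr (1 / r) \<le> (\<Sum>i\<in>I. x i powr r) powr (1 / r)"
    using r by (intro powr_mono2) auto
  moreover have "(card I * c powr r) powr (1 / r) = card I powr (1 / r) * c"
    using n c r by (simp add: powr_mult powr_powr)
  ultimately have "card I powr (1 - 1 / r) * (card I powr (1 / r) * c)
     \<le> card I powr (1 - 1 / r) * (\<Sum>i\<in>I. x i powr r) powr (1 / r)"
    by (intro mult_left_mono) auto
  moreover have "card I powr (1 - 1 / r) * (card I powr (1 / r) * c) = (\<Sum>i\<in>I. x i)"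
    using n by (simp add: powr_diff c_def)
  ultimately show ?thesis by simp
qed simp

lemma ereal_ge_1_cases:
  assumes "(1 :: ereal) \<le> p"
  obtains "p = \<infinity>" | r where "p = ereal r" "1 \<le> r"
  using assms by (cases p) auto

text \<open>For finite \<open>p\<close> this is the power mean inequality on the absolute
  eigenvalues. For \<open>p = \<infinity>\<close> the exponent of \<open>n\<close> is 1 and each
  summand is at most the maximum.\<close>

lemma schatten_1_le:
  assumes "spectral_decomp n A W \<mu>" "A\<^sup>T = A" and n: "n \<ge> 1" and p: "1 \<le> p"
  shows "(\<Sum>i<n. \<bar>\<mu> i\<bar>) \<le> real n powr (1 - real_of_ereal (1 / p)) * schatten_norm p A"
  using p
proof (cases rule: ereal_ge_1_cases)
  case 1
  have "schatten_norm p A = Max ((\<lambda>i. \<bar>\<mu> i\<bar>) ` {..<n})"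
    unfolding schatten_norm_def singular_values_spectral_decomp[OF assms(1,2)] using 1 by simp
  moreover have "(\<Sum>i<n. \<bar>\<mu> i\<bar>) \<le> (\<Sum>i<n. Max ((\<lambda>i. \<bar>\<mu> i\<bar>) ` {..<n}))"
    by (intro sum_mono Max_ge) auto
  ultimately show ?thesis using 1 n by simp
next
  case (2 r)
  have "schatten_norm p A = (\<Sum>i<n. \<bar>\<mu> i\<bar> powr r) powr (1 / r)"
    unfolding schatten_norm_def singular_values_spectral_decomp[OF assms(1,2)] using 2
    by (simp add: image_mset.compositionality o_def sum_unfold_sum_mset)
  moreover have "real_of_ereal (1 / p) = 1 / r" using 2 by (simp add: one_ereal_def)
  ultimately show ?thesis
    using power_mean[of "{..<n}" "\<lambda>i. \<bar>\<mu> i\<bar>" r] 2 n by (simp add: lessThan_empty_iff)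
qed

section \<open>Moments of sign sums\<close>

text \<open>Extensional functions give exactly one element per sign pattern, so that counting
  elements computes probabilities.\<close>

definition signs :: "'i set \<Rightarrow> ('i \<Rightarrow> real) set" where
  "signs I = PiE I (\<lambda>_. {-1, 1})"

text \<open>Expectation over independent uniform signs as a finite average, so that moments need no
  measure theory.\<close>

definition sign_mean :: "'i set \<Rightarrow> (('i \<Rightarrow> real) \<Rightarrow> real) \<Rightarrow> real" where
  "sign_mean I f = (\<Sum>s\<in>signs I. f s) / 2 ^ card I"

definition lin :: "'i set \<Rightarrow> ('i \<Rightarrow> real) \<Rightarrow> ('i \<Rightarrow> real) \<Rightarrow> real" where
  "lin I a s = (\<Sum>i\<in>I. a i * s i)"

lemma finite_signs: "finite I \<Longrightarrow> finite (signs I)"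
  unfolding signs_def by (intro finite_PiE) auto

lemma card_signs: "finite I \<Longrightarrow> card (signs I) = 2 ^ card I"
  unfolding signs_def by (simp add: card_PiE numeral_2_eq_2)

lemma sign_mean_add: "sign_mean I (\<lambda>s. f s + g s) = sign_mean I f + sign_mean I g"
  unfolding sign_mean_def by (simp add: sum.distrib add_divide_distrib)

lemma sign_mean_cmult: "sign_mean I (\<lambda>s. c * f s) = c * sign_mean I f"
  unfolding sign_mean_def by (simp flip: sum_distrib_left)

lemma sign_mean_const: "finite I \<Longrightarrow> sign_mean I (\<lambda>s. c) = c"
  unfolding sign_mean_def by (simp add: card_signs)

lemma sign_mean_sum: "sign_mean I (\<lambda>s. \<Sum>k\<in>K. f k s) = (\<Sum>k\<in>K. sign_mean I (f k))"
  unfolding sign_mean_def by (subst sum.swap) (simp add: sum_divide_distrib)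

text \<open>Conditioning on all signs except the one at \<open>x\<close>; this drives both moment
  inductions.\<close>

lemma sign_mean_insert:
  assumes "finite I" "x \<notin> I"
  shows "sign_mean (insert x I) f =
    sign_mean I (\<lambda>s. (f (s(x := 1)) + f (s(x := -1))) / 2)"
proof -
  have "inj_on (\<lambda>(y, g). g(x := y)) ({-1, 1 :: real} \<times> signs I)"
    unfolding signs_def using inj_combinator[OF assms(2), of "\<lambda>_. {-1, 1 :: real}"] by simp
  then have "(\<Sum>s\<in>signs (insert x I). f s) = (\<Sum>(y, g)\<in>{-1, 1} \<times> signs I. f (g(x := y)))"
    unfolding signs_def PiE_insert_eq by (subst sum.reindex) (auto simp: case_prod_beta' o_def)
  also have "\<dots> = (\<Sum>s\<in>signs I. f (s(x := 1)) + f (s(x := -1)))"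
    by (simp add: sum.cartesian_product[symmetric] sum.distrib)
  finally show ?thesis
    unfolding sign_mean_def using assms by (simp flip: sum_divide_distrib)
qed

lemma lin_insert:
  assumes "finite I" "x \<notin> I"
  shows "lin (insert x I) a (s(x := y)) = a x * y + lin I a s"
  unfolding lin_def using assms by (auto intro!: sum.cong)

lemma sign_mean_2:
  assumes "finite I"
  shows "sign_mean I (\<lambda>s. lin I a s * lin I b s) = (\<Sum>i\<in>I. a i * b i)"
  using assms
proof (induction I)
  case empty
  then show ?case by (simp add: sign_mean_def lin_def)
next
  case (insert x I)
  have "sign_mean (insert x I) (\<lambda>s. lin (insert x I) a s * lin (insert x I) b s)
      = sign_mean I (\<lambda>s. lin I a s * lin I b s + a x * b x)"
    unfolding sign_mean_insert[OF insert.hyps] lin_insert[OF insert.hyps]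
    by (intro arg_cong[where f="sign_mean I"] ext) (simp add: field_simps)
  then show ?case
    using insert by (simp add: sign_mean_add sign_mean_const)
qed

text \<open>The three pairings are Wick's formula for Gaussians; the last sum corrects for the
  fourth moment of a sign being 1 instead of 3. In the induction, averaging over the new sign kills
  odd powers and leaves it in none, in two (six ways) or in all four of the factors.\<close>

lemma sign_mean_4:
  assumes "finite I"
  shows "sign_mean I (\<lambda>s. lin I a s * lin I b s * lin I c s * lin I e s) =
    (\<Sum>i\<in>I. a i * b i) * (\<Sum>i\<in>I. c i * e i) + (\<Sum>i\<in>I. a i * c i) * (\<Sum>i\<in>I. b i * e i)
    + (\<Sum>i\<in>I. a i * e i) * (\<Sum>i\<in>I. b i * c i) - 2 * (\<Sum>i\<in>I. a i * b i * c i * e i)"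
  using assms
proof (induction I)
  case empty
  then show ?case by (simp add: sign_mean_def lin_def)
next
  case (insert x I)
  let ?L = "lin I"
  have "sign_mean (insert x I) (\<lambda>s. lin (insert x I) a s * lin (insert x I) b s
        * lin (insert x I) c s * lin (insert x I) e s)
      = sign_mean I (\<lambda>s. ?L a s * ?L b s * ?L c s * ?L e s
          + (c x * e x) * (?L a s * ?L b s) + (b x * e x) * (?L a s * ?L c s)
          + (b x * c x) * (?L a s * ?L e s) + (a x * e x) * (?L b s * ?L c s)
          + (a x * c x) * (?L b s * ?L e s) + (a x * b x) * (?L c s * ?L e s)
          + a x * b x * c x * e x)"
    unfolding sign_mean_insert[OF insert.hyps] lin_insert[OF insert.hyps]
    by (intro arg_cong[where f="sign_mean I"] ext) (simp add: field_simps)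
  also have "\<dots> = sign_mean I (\<lambda>s. ?L a s * ?L b s * ?L c s * ?L e s)
          + (c x * e x) * (\<Sum>i\<in>I. a i * b i) + (b x * e x) * (\<Sum>i\<in>I. a i * c i)
          + (b x * c x) * (\<Sum>i\<in>I. a i * e i) + (a x * e x) * (\<Sum>i\<in>I. b i * c i)
          + (a x * c x) * (\<Sum>i\<in>I. b i * e i) + (a x * b x) * (\<Sum>i\<in>I. c i * e i)
          + a x * b x * c x * e x"
    using insert.hyps(1)
    by (simp only: sign_mean_add sign_mean_cmult sign_mean_const sign_mean_2)
  finally show ?case
    unfolding insert.IH using insert.hyps by (simp add: algebra_simps)
qed

lemma sum_kronecker_plus:
  fixes c :: real
  shows "(\<Sum>i<m. \<Sum>k<m. c + (if i = k then e else 0)) = real m * real m * c + real m * e"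
  by (simp add: sum.distrib algebra_simps)

text \<open>The correction in the fourth moment formula only lowers these moments, so the second
  moment is at most the Gaussian one: 3 for each diagonal pair and 1 for each other pair.
  Subtracting the squared mean leaves \<open>2 * m\<close>.\<close>

lemma sign_mean_chi_square:
  fixes a :: "nat \<Rightarrow> 'i \<Rightarrow> real"
  assumes I: "finite I"
    and orth: "\<And>i k. i < m \<Longrightarrow> k < m \<Longrightarrow> (\<Sum>n\<in>I. a i n * a k n) = (if i = k then 1 else 0)"
  shows "sign_mean I (\<lambda>s. ((\<Sum>i<m. (lin I (a i) s)\<^sup>2) - real m)\<^sup>2) \<le> 2 * real m"
proof -
  let ?Z = "\<lambda>s. \<Sum>i<m. (lin I (a i) s)\<^sup>2"
  have 1: "sign_mean I ?Z = m"
    using orth by (simp add: sign_mean_sum power2_eq_square sign_mean_2[OF I])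
  have "sign_mean I (\<lambda>s. (?Z s)\<^sup>2) = (\<Sum>i<m. \<Sum>k<m.
      sign_mean I (\<lambda>s. lin I (a i) s * lin I (a i) s * lin I (a k) s * lin I (a k) s))"
    by (simp add: power2_eq_square sum_product mult.assoc flip: sign_mean_sum)
  also have "\<dots> \<le> (\<Sum>i<m. \<Sum>k<m. 1 + (if i = k then 2 else 0))"
  proof (intro sum_mono)
    fix i k assume ik: "i \<in> {..<m}" "k \<in> {..<m}"
    have "(\<Sum>n\<in>I. a i n * a i n * a k n * a k n) = (\<Sum>n\<in>I. (a i n * a k n)\<^sup>2)"
      by (simp add: power2_eq_square algebra_simps)
    then have "(\<Sum>n\<in>I. a i n * a i n * a k n * a k n) \<ge> 0" by (simp add: sum_nonneg)
    then show "sign_mean I (\<lambda>s. lin I (a i) s * lin I (a i) s * lin I (a k) s * lin I (a k) s)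
        \<le> 1 + (if i = k then 2 else 0)"
      using ik by (cases "i = k") (auto simp: sign_mean_4[OF I] orth)
  qed
  also have "\<dots> = real m * real m + 2 * real m" unfolding sum_kronecker_plus by simp
  finally have 2: "sign_mean I (\<lambda>s. (?Z s)\<^sup>2) \<le> real m * real m + 2 * real m" .
  have "sign_mean I (\<lambda>s. (?Z s - real m)\<^sup>2)
      = sign_mean I (\<lambda>s. (?Z s)\<^sup>2 + ((- 2 * real m) * ?Z s + real m * real m))"
    by (simp add: power2_eq_square algebra_simps)
  also have "\<dots> = sign_mean I (\<lambda>s. (?Z s)\<^sup>2) + (- 2 * real m * real m + real m * real m)"
    unfolding sign_mean_add sign_mean_cmult sign_mean_const[OF I] 1 ..
  finally show ?thesis using 2 by simp
qed

text \<open>For \<open>i \<noteq> k\<close> all three pairings vanish by orthogonality, and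
  \<open>disj\<close> makes the correction vanish too. For \<open>i = k\<close> only the pairing of
  \<open>a\<close> with \<open>a\<close> and \<open>b\<close> with \<open>b\<close> survives, and
  the correction has the favourable sign.\<close>

lemma sign_mean_cross:
  fixes a b :: "nat \<Rightarrow> 'i \<Rightarrow> real"
  assumes I: "finite I"
    and aa: "\<And>i k. i < m \<Longrightarrow> k < m \<Longrightarrow> (\<Sum>n\<in>I. a i n * a k n) = (if i = k then 1 else 0)"
    and bb: "\<And>i k. i < m \<Longrightarrow> k < m \<Longrightarrow> (\<Sum>n\<in>I. b i n * b k n) = (if i = k then 1 else 0)"
    and ab: "\<And>i k. i < m \<Longrightarrow> k < m \<Longrightarrow> (\<Sum>n\<in>I. a i n * b k n) = 0"
    and disj: "\<And>i k n. i \<noteq> k \<Longrightarrow> a i n * a k n = 0"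
  shows "sign_mean I (\<lambda>s. (\<Sum>i<m. lin I (a i) s * lin I (b i) s)\<^sup>2) \<le> real m"
proof -
  have "sign_mean I (\<lambda>s. (\<Sum>i<m. lin I (a i) s * lin I (b i) s)\<^sup>2) = (\<Sum>i<m. \<Sum>k<m.
      sign_mean I (\<lambda>s. lin I (a i) s * lin I (b i) s * lin I (a k) s * lin I (b k) s))"
    by (simp add: power2_eq_square sum_product mult.assoc flip: sign_mean_sum)
  also have "\<dots> \<le> (\<Sum>i<m. \<Sum>k<m. 0 + (if i = k then 1 else 0))"
  proof (intro sum_mono)
    fix i k assume ik: "i \<in> {..<m}" "k \<in> {..<m}"
    have "a i n * b i n * a k n * b k n \<ge> 0" for n
    proof (cases "i = k")
      case True
      then have "a i n * b i n * a k n * b k n = (a i n * b i n)\<^sup>2"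
        by (simp add: power2_eq_square)
      then show ?thesis by simp
    next
      case False
      have "a i n * b i n * a k n * b k n = (a i n * a k n) * (b i n * b k n)" by simp
      then show ?thesis using disj[OF False, of n] by auto
    qed
    then have "(\<Sum>n\<in>I. a i n * b i n * a k n * b k n) \<ge> 0" by (simp add: sum_nonneg)
    moreover have "(\<Sum>n\<in>I. b i n * a k n) = 0"
      using ab[of k i] ik by (simp add: mult.commute)
    ultimately show "sign_mean I (\<lambda>s. lin I (a i) s * lin I (b i) s * lin I (a k) s * lin I (b k) s)
        \<le> 0 + (if i = k then 1 else 0)"
      using ik by (cases "i = k") (auto simp: sign_mean_4[OF I] aa bb ab)
  qed
  also have "\<dots> = real m" unfolding sum_kronecker_plus by simp
  finally show ?thesis .
qed

text \<open>Markov's inequality, multiplied through by the number of sign patterns.\<close>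

lemma card_signs_Markov:
  assumes I: "finite I" and f: "\<And>s. s \<in> signs I \<Longrightarrow> 0 \<le> f s"
  shows "t * real (card {s \<in> signs I. t \<le> f s}) \<le> sign_mean I f * 2 ^ card I"
proof -
  have "t * real (card {s \<in> signs I. t \<le> f s}) = (\<Sum>s\<in>{s \<in> signs I. t \<le> f s}. t)" by simp
  also have "\<dots> \<le> (\<Sum>s\<in>{s \<in> signs I. t \<le> f s}. f s)" by (intro sum_mono) auto
  also have "\<dots> \<le> (\<Sum>s\<in>signs I. f s)" using f finite_signs[OF I] by (intro sum_mono2) auto
  finally show ?thesis unfolding sign_mean_def by simp
qed

section \<open>The sketched quadratic form\<close>

text \<open>All \<open>m\<close> queries are cut from a single sign vector of length
  \<open>m * d\<close>. Placing \<open>v\<close> in the \<open>i\<close>-th segment turns its inner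
  product with query \<open>i\<close> into a linear form in all signs, and distinct segments have
  disjoint supports.\<close>

definition block :: "nat \<Rightarrow> nat \<Rightarrow> (nat \<Rightarrow> real) \<Rightarrow> nat \<Rightarrow> real" where
  "block d i v n = (if n div d = i then v (n mod d) else 0)"

lemma sum_block:
  assumes "i < m"
  shows "(\<Sum>n<m * d. block d i v n * f n) = (\<Sum>j<d. v j * f (i * d + j))"
proof -
  have "n div d = i \<longleftrightarrow> n \<in> {i * d..<i * d + d}" if "n < m * d" for n
  proof -
    have "d > 0" using that by (cases d) auto
    then show ?thesis
      using dividend_less_div_times[of d n] div_times_less_eq_dividend[of n d]
      by (auto intro!: div_nat_eqI simp: algebra_simps)
  qed
  moreover have sub: "{i * d..<i * d + d} \<subseteq> {..<m * d}"
    using mult_le_mono1[of "Suc i" m d] assms by auto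
  ultimately have "(\<Sum>n<m * d. block d i v n * f n) = (\<Sum>n\<in>{i * d..<i * d + d}. v (n - i * d) * f n)"
    by (intro sum.mono_neutral_cong_right) (auto simp: block_def modulo_nat_def)
  also have "\<dots> = (\<Sum>j<d. v j * f (i * d + j))"
    by (intro sum.reindex_bij_witness[of _ "\<lambda>j. i * d + j" "\<lambda>n. n - i * d"]) auto
  finally show ?thesis .
qed

lemma sum_block_block:
  assumes "i < m"
  shows "(\<Sum>n<m * d. block d i v n * block d k w n) = (if i = k then \<Sum>j<d. v j * w j else 0)"
  unfolding sum_block[OF assms] by (auto simp: block_def intro!: sum.neutral)

definition query :: "nat \<Rightarrow> (nat \<Rightarrow> real) \<Rightarrow> nat \<Rightarrow> real vec" where
  "query d s i = vec d (\<lambda>j. s (i * d + j))"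

lemma query_carrier [simp]: "query d s i \<in> carrier_vec d"
  unfolding query_def by simp

lemma lin_block:
  assumes "i < m" "v \<in> carrier_vec d"
  shows "lin {..<m * d} (block d i (vec_index v)) s = v \<bullet> query d s i"
  unfolding lin_def sum_block[OF assms(1)] using assms(2)
  by (simp add: scalar_prod_def query_def lessThan_atLeast0)

lemma bilinear_spectral_decomp:
  assumes D: "spectral_decomp d A W \<mu>" and g: "g \<in> carrier_vec d" and h: "h \<in> carrier_vec d"
  shows "g \<bullet> (A *\<^sub>v h) = (\<Sum>l<d. \<mu> l * (col W l \<bullet> g) * (col W l \<bullet> h))"
proof -
  note D = spectral_decompD[OF D]
  have Wh: "W\<^sup>T *\<^sub>v h \<in> carrier_vec d" using D h by simp
  have "A *\<^sub>v h = W *\<^sub>v (mat_diag d \<mu> *\<^sub>v (W\<^sup>T *\<^sub>v h))"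
    by (subst D(6)) (use D(2) h in \<open>simp add: assoc_mult_mat_vec[of _ d d _ d]\<close>)
  also have "g \<bullet> \<dots> = (W\<^sup>T *\<^sub>v g) \<bullet> (mat_diag d \<mu> *\<^sub>v (W\<^sup>T *\<^sub>v h))"
    using transpose_vec_mult_scalar[of W d d "mat_diag d \<mu> *\<^sub>v (W\<^sup>T *\<^sub>v h)" g] D(2) g
      mult_mat_vec_carrier[OF mat_diag_dim Wh] by simp
  also have "mat_diag d \<mu> *\<^sub>v (W\<^sup>T *\<^sub>v h) = vec d (\<lambda>l. \<mu> l * (col W l \<bullet> h))"
  proof (intro eq_vecI)
    fix l assume l: "l < dim_vec (vec d (\<lambda>l. \<mu> l * (col W l \<bullet> h)))"
    have "(mat_diag d \<mu> *\<^sub>v (W\<^sup>T *\<^sub>v h)) $ l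
        = (\<Sum>j = 0..<d. (if l = j then \<mu> j else 0) * (col W j \<bullet> h))"
      using l D(2) by (simp add: mat_diag_def scalar_prod_def[of "Matrix.row (mat_diag d \<mu>) l" for l])
        (simp add: scalar_prod_def[of "vec d f" for f])
    also have "\<dots> = (\<Sum>j = 0..<d. if l = j then \<mu> j * (col W j \<bullet> h) else 0)"
      by (intro sum.cong) auto
    finally show "(mat_diag d \<mu> *\<^sub>v (W\<^sup>T *\<^sub>v h)) $ l = vec d (\<lambda>l. \<mu> l * (col W l \<bullet> h)) $ l"
      using l by simp
  qed (use D in \<open>simp add: mat_diag_def\<close>)
  also have "(W\<^sup>T *\<^sub>v g) \<bullet> \<dots> = (\<Sum>l<d. \<mu> l * (col W l \<bullet> g) * (col W l \<bullet> h))"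
    using D(2) by (simp add: scalar_prod_def[of "W\<^sup>T *\<^sub>v g"] lessThan_atLeast0 mult.left_commute mult.assoc)
  finally show ?thesis .
qed

lemma col_spectral_decomp:
  assumes D: "spectral_decomp d A W \<mu>" and i: "i < d" and j: "j < d"
  shows "col W i \<bullet> col W j = (if i = j then 1 else 0)"
proof -
  note D = spectral_decompD[OF D]
  have "col W i \<bullet> col W j = (W\<^sup>T * W) $$ (i, j)" using D(2) i j by simp
  then show ?thesis unfolding D(3) using i j by simp
qed

lemma psd_spectral_decomp:
  assumes D: "spectral_decomp d A W \<mu>" and "psd A" "l < d"
  shows "0 \<le> \<mu> l"
proof -
  have W: "col W l \<in> carrier_vec d" using spectral_decompD(2)[OF D] by (auto simp: col_carrier_vec assms)
  have "0 \<le> col W l \<bullet> (A *\<^sub>v col W l)"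
    using assms W spectral_decompD(1)[OF D] unfolding psd_def by auto
  also have "\<dots> = (\<Sum>k<d. if k = l then \<mu> l else 0)"
    unfolding bilinear_spectral_decomp[OF D W W]
    by (intro sum.cong) (use assms col_spectral_decomp[OF D] in auto)
  finally show ?thesis using assms(3) by simp
qed

text \<open>This is \<open>x \<bullet> A x\<close> for the combination \<open>x\<close> of the
  queries with coefficients \<open>c\<close>, written so that \<open>A\<close> enters only through
  the answers to the queries.\<close>

definition sketch_form :: "nat \<Rightarrow> nat \<Rightarrow> real mat \<Rightarrow> (nat \<Rightarrow> real) \<Rightarrow> (nat \<Rightarrow> real) \<Rightarrow> real" where
  "sketch_form d m A s c = (\<Sum>i<m. \<Sum>k<m. c i * c k * (query d s i \<bullet> (A *\<^sub>v query d s k)))"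

text \<open>In the eigenbasis the form is a sum of squares weighted by eigenvalues. This yields both
  acceptance of PSD matrices and the upper bound used for rejection.\<close>

lemma sketch_form_spectral_decomp:
  assumes D: "spectral_decomp d A W \<mu>"
  shows "sketch_form d m A s c = (\<Sum>l<d. \<mu> l * (\<Sum>i<m. c i * (col W l \<bullet> query d s i))\<^sup>2)"
proof -
  have "sketch_form d m A s c = (\<Sum>i<m. \<Sum>k<m. \<Sum>l<d.
      \<mu> l * ((c i * (col W l \<bullet> query d s i)) * (c k * (col W l \<bullet> query d s k))))"
    unfolding sketch_form_def bilinear_spectral_decomp[OF D query_carrier query_carrier]
    by (simp add: sum_distrib_left mult_ac)
  also have "\<dots> = (\<Sum>i<m. \<Sum>l<d. \<Sum>k<m.
      \<mu> l * ((c i * (col W l \<bullet> query d s i)) * (c k * (col W l \<bullet> query d s k))))"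
    by (intro sum.cong refl sum.swap)
  also have "\<dots> = (\<Sum>l<d. \<Sum>i<m. \<Sum>k<m.
      \<mu> l * ((c i * (col W l \<bullet> query d s i)) * (c k * (col W l \<bullet> query d s k))))"
    by (rule sum.swap)
  also have "\<dots> = (\<Sum>l<d. \<mu> l * (\<Sum>i<m. c i * (col W l \<bullet> query d s i))\<^sup>2)"
    by (simp add: power2_eq_square sum_product flip: sum_distrib_left)
  finally show ?thesis .
qed

section \<open>Probability that the eigenvector witness fails\<close>

text \<open>With coefficients taken from the eigenvector of \<open>- lam\<close>, the negative part
  of the form is \<open>lam\<close> times the square of a concentrated sum \<open>Z\<close>. The
  other eigenvalues contribute at most \<open>R\<close>, which is controlled in mean.\<close>

lemma card_sketch_form_nonneg:
  assumes D: "spectral_decomp d A W \<mu>" and k0: "k0 < d" and lam: "\<mu> k0 = - lam" "lam > 0"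
    and m: "36 * (\<Sum>l<d. \<bar>\<mu> l\<bar>) \<le> lam * real m"
  shows "card {s \<in> signs {..<m * d}. 0 \<le> sketch_form d m A s (\<lambda>i. col W k0 \<bullet> query d s i)}
    \<le> (1 / 3 :: real) * 2 ^ (m * d)"
proof -
  let ?I = "{..<m * d}" and ?N = "\<Sum>l<d. \<bar>\<mu> l\<bar>"
  define a where "a = (\<lambda>l i. block d i (vec_index (col W l)))"
  have W: "col W l \<in> carrier_vec d" if "l < d" for l
    using spectral_decompD(2)[OF D] that by auto
  have lin_a: "lin ?I (a l i) s = col W l \<bullet> query d s i" if "l < d" "i < m" for l i s
    unfolding a_def using lin_block[OF that(2) W[OF that(1)]] .
  have orth: "(\<Sum>n\<in>?I. a l i n * a l' k n) = (if i = k \<and> l = l' then 1 else 0)"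
    if "l < d" "l' < d" "i < m" for l l' i k
    unfolding a_def sum_block_block[OF that(3)]
    using col_spectral_decomp[OF D that(1,2)] spectral_decompD(2)[OF D]
    by (auto simp: scalar_prod_def lessThan_atLeast0)
  define Z where "Z = (\<lambda>s. \<Sum>i<m. (lin ?I (a k0 i) s)\<^sup>2)"
  define Y where "Y = (\<lambda>l s. \<Sum>i<m. lin ?I (a k0 i) s * lin ?I (a l i) s)"
  define R where "R = (\<lambda>s. \<Sum>l\<in>{..<d} - {k0}. \<bar>\<mu> l\<bar> * (Y l s)\<^sup>2)"
  have form: "sketch_form d m A s (\<lambda>i. col W k0 \<bullet> query d s i) \<le> R s - lam * (Z s)\<^sup>2" for s
  proof -
    have "sketch_form d m A s (\<lambda>i. col W k0 \<bullet> query d s i) = (\<Sum>l<d. \<mu> l * (Y l s)\<^sup>2)"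
      unfolding sketch_form_spectral_decomp[OF D] Y_def using k0 by (simp add: lin_a)
    also have "\<dots> = \<mu> k0 * (Y k0 s)\<^sup>2 + (\<Sum>l\<in>{..<d} - {k0}. \<mu> l * (Y l s)\<^sup>2)"
      using k0 by (subst sum.remove[of _ k0]) auto
    also have "Y k0 s = Z s" unfolding Y_def Z_def by (simp add: power2_eq_square)
    also have "(\<Sum>l\<in>{..<d} - {k0}. \<mu> l * (Y l s)\<^sup>2) \<le> R s"
      unfolding R_def by (intro sum_mono mult_right_mono) auto
    finally show ?thesis using lam by simp
  qed
  \<comment> \<open>Since \<open>lam\<close> is one of the summands of \<open>?N\<close>, hypothesis
    \<open>m\<close> also forces at least 36 queries.\<close>
  have "lam \<le> ?N" using member_le_sum[of k0 "{..<d}" "\<lambda>l. \<bar>\<mu> l\<bar>"] k0 lam by simp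
  then have "lam * 36 \<le> lam * real m" using m by simp
  then have m36: "real m \<ge> 36" using lam by simp
  have meanZ: "sign_mean ?I (\<lambda>s. (Z s - real m)\<^sup>2) \<le> 2 * real m"
    unfolding Z_def using k0 by (intro sign_mean_chi_square) (auto simp: orth)
  have "sign_mean ?I (\<lambda>s. (Y l s)\<^sup>2) \<le> real m" if "l < d" "l \<noteq> k0" for l
    unfolding Y_def using k0 that
    by (intro sign_mean_cross) (auto simp: orth, auto simp: a_def block_def split: if_splits)
  then have "sign_mean ?I R \<le> (\<Sum>l\<in>{..<d} - {k0}. \<bar>\<mu> l\<bar> * real m)"
    unfolding R_def sign_mean_sum sign_mean_cmult by (intro sum_mono mult_left_mono) auto
  also have "\<dots> \<le> ?N * real m"
    unfolding sum_distrib_right by (intro sum_mono2) auto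
  finally have meanR: "sign_mean ?I R \<le> ?N * real m" .
  \<comment> \<open>Outside both bad sets \<open>Z\<close> is at least \<open>m / 2\<close>, so the
    negative part outweighs \<open>R\<close>. By Chebyshev the first set has probability at most
    \<open>8 / m\<close>, hence at most 8/36. By Markov the second has at most
    \<open>4 * ?N / (lam * m)\<close>, hence at most 4/36. The total is 1/3.\<close>
  let ?B1 = "{s \<in> signs ?I. (real m)\<^sup>2 / 4 \<le> (Z s - real m)\<^sup>2}"
  let ?B2 = "{s \<in> signs ?I. lam * (real m)\<^sup>2 / 4 \<le> R s}"
  have sub: "{s \<in> signs ?I. 0 \<le> sketch_form d m A s (\<lambda>i. col W k0 \<bullet> query d s i)} \<subseteq> ?B1 \<union> ?B2"
  proof (intro subsetI, rule ccontr)
    fix s assume s: "s \<in> {s \<in> signs ?I. 0 \<le> sketch_form d m A s (\<lambda>i. col W k0 \<bullet> query d s i)}"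
      and "s \<notin> ?B1 \<union> ?B2"
    then have 1: "(Z s - real m)\<^sup>2 < (real m / 2)\<^sup>2" and 2: "R s < lam * (real m)\<^sup>2 / 4"
      by (auto simp: power_divide)
    have "\<bar>Z s - real m\<bar> < real m / 2"
      using 1 m36 by (metis abs_le_square_iff abs_of_nonneg divide_nonneg_nonneg linorder_not_le
          of_nat_0_le_iff zero_le_numeral)
    then have "real m / 2 \<le> Z s" by linarith
    then have "(real m / 2)\<^sup>2 \<le> (Z s)\<^sup>2" by (intro power_mono) auto
    then have "lam * ((real m)\<^sup>2 / 4) \<le> lam * (Z s)\<^sup>2" using lam
      by (simp add: power_divide)
    then show False using form[of s] s 2 by auto
  qed
  have "(real m)\<^sup>2 / 4 * card ?B1 \<le> sign_mean ?I (\<lambda>s. (Z s - real m)\<^sup>2) * 2 ^ card ?I"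
    by (rule card_signs_Markov) auto
  also have "\<dots> \<le> 2 * real m * 2 ^ card ?I" using meanZ by (intro mult_right_mono) auto
  finally have "real m * (real m * card ?B1) \<le> real m * (8 * 2 ^ (m * d))"
    by (simp add: power2_eq_square field_simps)
  then have "real m * card ?B1 \<le> 8 * 2 ^ (m * d)" using m36 by (subst (asm) mult_le_cancel_left_pos) auto
  moreover have "36 * real (card ?B1) \<le> real m * card ?B1" using m36 by (intro mult_right_mono) auto
  ultimately have B1: "36 * real (card ?B1) \<le> 8 * 2 ^ (m * d)" by linarith
  have "lam * (real m)\<^sup>2 / 4 * card ?B2 \<le> sign_mean ?I R * 2 ^ card ?I"
    by (rule card_signs_Markov) (auto simp: R_def sum_nonneg)
  also have "\<dots> \<le> ?N * real m * 2 ^ card ?I" using meanR by (intro mult_right_mono) auto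
  finally have "real m * (lam * real m * card ?B2) \<le> real m * (4 * ?N * 2 ^ (m * d))"
    by (simp add: power2_eq_square field_simps)
  then have "lam * real m * card ?B2 \<le> 4 * ?N * 2 ^ (m * d)"
    using m36 by (subst (asm) mult_le_cancel_left_pos) auto
  moreover have "36 * ?N * real (card ?B2) \<le> lam * real m * card ?B2"
    using m by (intro mult_right_mono) auto
  ultimately have "?N * (36 * real (card ?B2)) \<le> ?N * (4 * 2 ^ (m * d))" by (simp add: mult_ac)
  then have B2: "36 * real (card ?B2) \<le> 4 * 2 ^ (m * d)"
    using \<open>lam \<le> ?N\<close> lam by (subst (asm) mult_le_cancel_left_pos) auto
  have "card {s \<in> signs ?I. 0 \<le> sketch_form d m A s (\<lambda>i. col W k0 \<bullet> query d s i)} \<le> card (?B1 \<union> ?B2)"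
    using sub finite_signs[of ?I] by (intro card_mono) auto
  also have "\<dots> \<le> card ?B1 + card ?B2" by (rule card_Un_le)
  finally show ?thesis using B1 B2 by simp
qed

section \<open>The tester: measurability and correctness\<close>

text \<open>The eigenvector coefficients are real in general, while the tester checks rational ones.
  The form is continuous in \<open>c\<close>, so negativity survives a close rational
  approximation.\<close>

lemma exists_rat_sketch_form_neg:
  assumes "sketch_form d m A s c < 0"
  shows "\<exists>r \<in> PiE {..<m} (\<lambda>_. \<rat>). sketch_form d m A s r < 0"
proof -
  have "\<exists>f. (\<forall>n. f n \<in> \<rat>) \<and> f \<longlonglongrightarrow> x" for x :: real
    using closure_sequential[of x "\<rat>"] Rats_closure_real by auto
  then obtain f :: "real \<Rightarrow> nat \<Rightarrow> real" where f: "\<And>x n. f x n \<in> \<rat>" "\<And>x. f x \<longlonglongrightarrow> x"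
    by metis
  have "(\<lambda>n. sketch_form d m A s (\<lambda>i. f (c i) n)) \<longlonglongrightarrow> sketch_form d m A s c"
    unfolding sketch_form_def by (intro tendsto_intros f)
  then have "\<forall>\<^sub>F n in sequentially. sketch_form d m A s (\<lambda>i. f (c i) n) < 0"
    using assms by (rule order_tendstoD)
  then obtain n where "sketch_form d m A s (\<lambda>i. f (c i) n) < 0"
    by (auto simp: eventually_sequentially)
  then show ?thesis
    \<comment> \<open>Restricting makes the coefficients extensional; the form reads only the
      indices below \<open>m\<close>.\<close>
    by (intro bexI[of _ "restrict (\<lambda>i. f (c i) n) {..<m}"]) (auto simp: sketch_form_def f)
qed

text \<open>The output quantifies over rational coefficients only, so that it is measurable as a countable
  conjunction.\<close>

definition sketch_tester :: "nat \<Rightarrow> nat \<Rightarrow> (nat \<Rightarrow> real) mv_algorithm" where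
  "sketch_tester d m =
    \<lparr>coins = uniform_count_measure (signs {..<m * d}),
     next_query = (\<lambda>s ys. if length ys < m then Some (query d s (length ys)) else None),
     decide = (\<lambda>s ys. \<forall>c \<in> PiE {..<m} (\<lambda>_. \<rat>).
       0 \<le> (\<Sum>i<m. \<Sum>k<m. c i * c k * (query d s i \<bullet> ys ! k)))\<rparr>"

lemma space_sketch_tester [simp]: "space (coins (sketch_tester d m)) = signs {..<m * d}"
  unfolding sketch_tester_def by (simp add: space_uniform_count_measure)

lemma answers_sketch_tester:
  "answers (sketch_tester d m) A s n = map (\<lambda>i. A *\<^sub>v query d s i) [0..<min n m]"
  by (induction n) (auto simp: sketch_tester_def min_def le_Suc_eq not_le)

lemma stopped_sketch_tester: "stopped (sketch_tester d m) A s n \<longleftrightarrow> m \<le> n"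
  unfolding stopped_def answers_sketch_tester by (auto simp: sketch_tester_def)

lemma num_queries_sketch_tester: "num_queries (sketch_tester d m) A s = m"
  unfolding num_queries_def stopped_sketch_tester by (intro Least_equality) auto

lemma run_output_sketch_tester:
  "run_output (sketch_tester d m) A s \<longleftrightarrow> (\<forall>c \<in> PiE {..<m} (\<lambda>_. \<rat>). 0 \<le> sketch_form d m A s c)"
  unfolding run_output_def num_queries_sketch_tester answers_sketch_tester
  by (simp add: sketch_tester_def sketch_form_def)

text \<open>The coins are finite and discrete, so joint measurability reduces to each fixed outcome.
  There the output is a countable conjunction of inequalities between measurable functions of the
  matrix entries.\<close>

lemma valid_sketch_tester: "valid_algorithm d (sketch_tester d m)"
  unfolding valid_algorithm_def
proof (intro conjI ballI allI impI)
  have "signs {..<m * d} \<noteq> {}" by (simp add: signs_def PiE_eq_empty_iff)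
  then show "prob_space (coins (sketch_tester d m))"
    unfolding sketch_tester_def by (simp add: prob_space_uniform_count_measure finite_signs)
next
  let ?S = "signs {..<m * d}" and ?P = "Pi\<^sub>M {(i, j). i \<le> j \<and> j < d} (\<lambda>_. borel :: real measure)"
  \<comment> \<open>Sorting the two indices lands in the upper triangle that indexes the product
    space.\<close>
  have comp: "(\<lambda>a. a (min i j, max i j)) \<in> borel_measurable ?P" if "i < d" "j < d" for i j
    using that by (intro measurable_component_singleton) auto
  have "(\<lambda>a. sketch_form d m (sym_mat_of d a) s c) \<in> borel_measurable ?P" for s c
    unfolding sketch_form_def
  proof (intro borel_measurable_sum borel_measurable_times borel_measurable_const)
    fix i k
    have "query d s i \<bullet> (sym_mat_of d a *\<^sub>v query d s k)
        = (\<Sum>j = 0..<d. \<Sum>l = 0..<d. s (i * d + j) * (a (min j l, max j l) * s (k * d + l)))" for a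
      by (simp add: scalar_prod_def sym_mat_of_def query_def sum_distrib_left)
    then show "(\<lambda>a. query d s i \<bullet> (sym_mat_of d a *\<^sub>v query d s k)) \<in> borel_measurable ?P"
      by (simp only:) (intro borel_measurable_sum borel_measurable_times borel_measurable_const comp; simp)
  qed
  then have "Measurable.pred ?P (\<lambda>a. 0 \<le> sketch_form d m (sym_mat_of d a) s c)" for s c
    by measurable
  moreover have "countable (PiE {..<m} (\<lambda>_. \<rat> :: real set))"
    by (intro countable_PiE countable_rat) auto
  ultimately have "Measurable.pred ?P (\<lambda>a. run_output (sketch_tester d m) (sym_mat_of d a) s)" for s
    unfolding run_output_sketch_tester pred_def by (intro sets.sets_Collect_countable_All')
  then have "Measurable.pred (count_space ?S \<Otimes>\<^sub>M ?P)
      (\<lambda>x. run_output (sketch_tester d m) (sym_mat_of d (snd x)) (fst x))"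
    by (intro measurable_pair_measure_countable1) (auto intro: countable_finite finite_signs)
  moreover have eq: "sets (coins (sketch_tester d m) \<Otimes>\<^sub>M ?P) = sets (count_space ?S \<Otimes>\<^sub>M ?P)"
    by (intro sets_pair_measure_cong) (auto simp: sketch_tester_def sets_uniform_count_measure)
  ultimately show "Measurable.pred (coins (sketch_tester d m) \<Otimes>\<^sub>M ?P)
      (\<lambda>(s, a). run_output (sketch_tester d m) (sym_mat_of d a) s)"
    by (subst measurable_cong_sets[OF eq refl]) (simp add: case_prod_beta')
qed (auto simp: sketch_tester_def stopped_sketch_tester[unfolded sketch_tester_def] split: if_splits)

lemma non_adaptive_sketch_tester: "non_adaptive (sketch_tester d m)"
  unfolding non_adaptive_def
  by (rule exI[of _ "\<lambda>s. map (query d s) [0..<m]"]) (auto simp: sketch_tester_def)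

lemma one_sided_sketch_tester: "one_sided d (sketch_tester d m)"
  unfolding one_sided_def run_output_sketch_tester
proof (intro ballI impI)
  fix A s c assume A: "A \<in> sym_mats d" "psd A"
  obtain W \<mu> where D: "spectral_decomp d A W \<mu>" using symmetric_spectral_decomp[OF A(1)] .
  show "0 \<le> sketch_form d m A s c"
    unfolding sketch_form_spectral_decomp[OF D]
    using psd_spectral_decomp[OF D A(2)] by (intro sum_nonneg mult_nonneg_nonneg) auto
qed

text \<open>The norm comparison turns the gap in the Schatten norm into
  \<open>36 * ?N \<le> lam * m\<close>, the hypothesis of the failure bound. The constant 36 in
  \<open>m\<close> comes from there.\<close>

lemma is_tester_sketch_tester:
  assumes d: "1 \<le> d" and p: "1 \<le> p" and \<epsilon>: "0 < \<epsilon>"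
    and m: "36 * real d powr (1 - real_of_ereal (1 / p)) \<le> \<epsilon> * real m"
  shows "is_tester d \<epsilon> p (sketch_tester d m)"
  unfolding is_tester_def
proof (intro conjI ballI impI valid_sketch_tester)
  let ?T = "sketch_tester d m" and ?S = "signs {..<m * d}"
  have meas: "measure (coins ?T) X = card X / 2 ^ (m * d)" if "X \<subseteq> ?S" for X
    unfolding sketch_tester_def using that
    by (simp add: measure_uniform_count_measure finite_signs card_signs)
  {
    fix A assume "A \<in> sym_mats d" "psd A"
    then have "{s \<in> space (coins ?T). run_output ?T A s} = ?S"
      using one_sided_sketch_tester[of d m] unfolding one_sided_def by auto
    then show "2 / 3 \<le> measure (coins ?T) {s \<in> space (coins ?T). run_output ?T A s}"
      by (simp add: meas card_signs)
  next
    fix A assume A: "A \<in> sym_mats d" "A \<noteq> 0\<^sub>m d d \<and> lambda_min A \<le> - \<epsilon> * schatten_norm p A"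
    obtain W \<mu> where D: "spectral_decomp d A W \<mu>" using symmetric_spectral_decomp[OF A(1)] .
    let ?N = "\<Sum>l<d. \<bar>\<mu> l\<bar>" and ?D = "real d powr (1 - real_of_ereal (1 / p))"
    have "lambda_min A \<in> \<mu> ` {..<d}"
      unfolding lambda_min_def spectrum_spectral_decomp[OF D] using d by (intro Min_in) (auto simp: lessThan_empty_iff)
    then obtain k0 where k0: "k0 < d" "\<mu> k0 = lambda_min A" by auto
    define lam where "lam = - lambda_min A"
    have N: "?N \<le> ?D * schatten_norm p A"
      using schatten_1_le[OF D _ d p] A(1) unfolding sym_mats_def by auto
    \<comment> \<open>A nonzero \<open>A\<close> has a nonzero eigenvalue, which makes the Schatten
      norm, and hence \<open>lam\<close>, strictly positive.\<close>
    have "?N \<noteq> 0"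
    proof
      assume "?N = 0"
      then have "mat_diag d \<mu> = 0\<^sub>m d d"
        by (auto simp: sum_nonneg_eq_0_iff mat_diag_def intro!: eq_matI)
      then show False
        using spectral_decompD(2,6)[OF D] A(2) by simp
    qed
    then have N0: "?N > 0" by (metis abs_ge_zero order_le_less sum_nonneg)
    have D0: "?D > 0" using d by simp
    have S0: "schatten_norm p A > 0" using N N0 D0 by (smt (verit) zero_less_mult_pos)
    have lam_ge: "\<epsilon> * schatten_norm p A \<le> lam" using A(2) unfolding lam_def by simp
    then have lam0: "lam > 0" using S0 \<epsilon> by (smt (verit) mult_pos_pos)
    have "36 * ?N \<le> 36 * ?D * schatten_norm p A" using N by simp
    also have "\<dots> \<le> \<epsilon> * real m * schatten_norm p A" using m S0 by (intro mult_right_mono) auto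
    also have "\<dots> = (\<epsilon> * schatten_norm p A) * real m" by simp
    also have "\<dots> \<le> lam * real m" using lam_ge by (intro mult_right_mono) auto
    finally have m': "36 * ?N \<le> lam * real m" .
    let ?G = "{s \<in> ?S. 0 \<le> sketch_form d m A s (\<lambda>i. col W k0 \<bullet> query d s i)}"
    have G: "card ?G \<le> (1 / 3 :: real) * 2 ^ (m * d)"
      by (rule card_sketch_form_nonneg[OF D k0(1) _ lam0 m']) (simp add: k0 lam_def)
    have "\<not> run_output ?T A s" if "s \<in> ?S - ?G" for s
      using exists_rat_sketch_form_neg[of d m A s "\<lambda>i. col W k0 \<bullet> query d s i"] that
      unfolding run_output_sketch_tester by force
    then have sub: "?S - ?G \<subseteq> {s \<in> ?S. \<not> run_output ?T A s}" by auto
    have "(2 / 3 :: real) * 2 ^ (m * d) \<le> real (card ?S) - card ?G"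
      using G by (simp add: card_signs)
    also have "\<dots> = card (?S - ?G)"
      by (subst card_Diff_subset)
        (auto simp: finite_signs intro!: of_nat_diff[symmetric] card_mono)
    also have "\<dots> \<le> card {s \<in> ?S. \<not> run_output ?T A s}"
      using sub by (simp add: card_mono finite_signs)
    finally show "2 / 3 \<le> measure (coins ?T) {s \<in> space (coins ?T). \<not> run_output ?T A s}"
      by (simp add: meas field_simps)
  }
qed

theorem proposition43:
  shows "\<exists>C > (0 :: real). \<forall>d \<ge> (1 :: nat). \<forall>p \<ge> (1 :: ereal). \<forall>\<epsilon> \<in> {0 <..< (1 :: real)}.
    \<exists>T :: (nat \<Rightarrow> real) mv_algorithm.
      is_tester d \<epsilon> p T \<and> one_sided d T \<and> non_adaptive T \<and>
      (\<forall>A \<in> sym_mats d. \<forall>w \<in> space (coins T).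
         real (num_queries T A w) \<le> C * (1 / \<epsilon>) * real d powr (1 - real_of_ereal (1 / p)))"
\<comment> \<open>The bound needs 36 times \<open>?D / \<epsilon>\<close> queries; rounding up costs
  at most one more, which is absorbed because \<open>?D / \<epsilon>\<close> is at least 1.\<close>
proof (intro exI[of _ 37] conjI allI impI ballI)
  fix d :: nat and p :: ereal and \<epsilon> :: real
  assume d: "1 \<le> d" and p: "1 \<le> p" and "\<epsilon> \<in> {0<..<1}"
  then have \<epsilon>: "0 < \<epsilon>" "\<epsilon> < 1" by auto
  let ?D = "real d powr (1 - real_of_ereal (1 / p))"
  define m where "m = nat \<lceil>36 * ?D / \<epsilon>\<rceil>"
  have "real_of_ereal (1 / p) \<le> 1"
    using p by (cases rule: ereal_ge_1_cases) (auto simp: one_ereal_def)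
  then have "1 \<le> ?D" using d by (intro ge_one_powr_ge_zero) auto
  then have "1 \<le> ?D / \<epsilon>" using \<epsilon> by (simp add: field_simps)
  moreover have "36 * ?D / \<epsilon> \<le> m" "m \<le> 36 * ?D / \<epsilon> + 1"
    unfolding m_def using \<epsilon> by (auto simp: real_nat_ceiling_ge intro: order_trans[OF _ of_int_ceiling_le_add_one])
  ultimately have "36 * ?D \<le> \<epsilon> * m" "m \<le> 37 * (1 / \<epsilon>) * ?D"
    using \<epsilon> by (auto simp: field_simps)
  then show "\<exists>T :: (nat \<Rightarrow> real) mv_algorithm.
      is_tester d \<epsilon> p T \<and> one_sided d T \<and> non_adaptive T \<and>
      (\<forall>A \<in> sym_mats d. \<forall>w \<in> space (coins T).
         real (num_queries T A w) \<le> 37 * (1 / \<epsilon>) * ?D)"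
    using is_tester_sketch_tester[OF d p \<epsilon>(1)] one_sided_sketch_tester non_adaptive_sketch_tester
    by (intro exI[of _ "sketch_tester d m"]) (simp add: num_queries_sketch_tester)
qed simp

end
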